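(* Let $\Omega$ be a domain in $\mathbb{R}^m$, let $u,v\in C^2(\Omega)$ be real-valued functions and let $\vec F=(F_1,\dots,F_m)\in C^1(\Omega)$ be a vector field. Suppose $N_{\vec F}(u)=N_{\vec F}(v)$ in $\Omega\setminus[S_{\vec F}(u)\cup S_{\vec F}(v)]$. Suppose that at each point of $\Omega\setminus[S_{\vec F}(u)\cup S_{\vec F}(v)]$, either $\Theta_u$ is nonintegrable or $\Theta_v$ is nonintegrable. Then $\nabla u=\nabla v$ in $\Omega\setminus[S_{\vec F}(u)\cup S_{\vec F}(v)]$.
   Context: For a real function $w$ on $\Omega$: the singular set is $S_{\vec F}(w) := \{p\in\Omega : (\nabla w+\vec F)(p)=0\}$; off it, the horizontal normal is $N_{\vec F}(w) := \frac{\nabla w+\vec F}{|\nabla w+\vec F|}$; and $\Theta_w := dw+\sum_I F_I\,dx^I$, a 1-form on $\Omega$, with $d\Theta_w = d(\sum_I F_I dx^I)=\sum_{I,J}\partial_J F_I\,dx^J\wedge dx^I$. $\Theta_w$ is called nonintegrable at a point $p$ if $\Theta_w\wedge d\Theta_w\ne0$ at $p$. The integer $m$ need not be even. *)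

theory Defs
  imports "HOL-Analysis.Analysis"
begin

definition partial_deriv :: "'m::finite \<Rightarrow> (real^'m \<Rightarrow> real) \<Rightarrow> real^'m \<Rightarrow> real" where
  "partial_deriv i f p = frechet_derivative f (at p) (axis i 1)"

definition grad :: "(real^'m::finite \<Rightarrow> real) \<Rightarrow> real^'m \<Rightarrow> real^'m" where
  "grad f p = (\<chi> i. partial_deriv i f p)"

lemma GDERIV_grad:
  assumes "f differentiable (at p)"
  shows "GDERIV f p :> grad f p"
proof -
  have D: "(f has_derivative frechet_derivative f (at p)) (at p)"
    using assms frechet_derivative_works by blast
  then have lin: "linear (frechet_derivative f (at p))"
    by (rule has_derivative_linear)
  have "frechet_derivative f (at p) h = h \<bullet> grad f p" for h
  proof -
    have "frechet_derivative f (at p) h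
        = frechet_derivative f (at p) (\<Sum>i\<in>UNIV. (h $ i) *\<^sub>R axis i 1)"
      using basis_expansion[of h] by (simp add: scalar_mult_eq_scaleR)
    also have "\<dots> = (\<Sum>i\<in>UNIV. (h $ i) * frechet_derivative f (at p) (axis i 1))"
      by (simp add: linear_sum[OF lin] linear_cmul[OF lin])
    finally show ?thesis
      by (simp add: grad_def partial_deriv_def inner_vec_def)
  qed
  then have "frechet_derivative f (at p) = (\<lambda>h. h \<bullet> grad f p)" by (rule ext)
  with D show ?thesis by (simp add: gderiv_def)
qed

text \<open>The class $C^k$, intended for open sets \<open>S\<close>; only the values of \<open>f\<close> on \<open>S\<close> matter then.\<close>

fun Ck_on :: "nat \<Rightarrow> (real^'m::finite) set \<Rightarrow> (real^'m \<Rightarrow> real) \<Rightarrow> bool" where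
  "Ck_on 0 S f \<longleftrightarrow> continuous_on S f"
| "Ck_on (Suc k) S f \<longleftrightarrow> f differentiable_on S \<and> (\<forall>i. Ck_on k S (partial_deriv i f))"

definition Ck_field_on :: "nat \<Rightarrow> (real^'m::finite) set \<Rightarrow> (real^'m \<Rightarrow> real^'m) \<Rightarrow> bool" where
  "Ck_field_on k S F \<longleftrightarrow> (\<forall>i. Ck_on k S (\<lambda>p. F p $ i))"

definition singular_set ::
  "(real^'m::finite) set \<Rightarrow> (real^'m \<Rightarrow> real^'m) \<Rightarrow> (real^'m \<Rightarrow> real) \<Rightarrow> (real^'m) set" where
  "singular_set \<Omega> F w = {p \<in> \<Omega>. grad w p + F p = 0}"

definition horizontal_normal ::
  "(real^'m::finite \<Rightarrow> real^'m) \<Rightarrow> (real^'m \<Rightarrow> real) \<Rightarrow> real^'m \<Rightarrow> real^'m" where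
  "horizontal_normal F w p = (grad w p + F p) /\<^sub>R norm (grad w p + F p)"

text \<open>
  A covector is represented by the functional \<open>X \<mapsto> \<alpha> X\<close>, an alternating 2- or 3-covector by
  the corresponding function of two or three tangent vectors, and a form by a function assigning
  such an object to each point. Wedge products use the normalisation without factorials, e.g.
  $(dx^1 \wedge dx^2)(e_1, e_2) = 1$.
\<close>

definition wedge_1_1 ::
  "(real^'m::finite \<Rightarrow> real) \<Rightarrow> (real^'m \<Rightarrow> real) \<Rightarrow> real^'m \<Rightarrow> real^'m \<Rightarrow> real" where
  "wedge_1_1 \<alpha> \<beta> X Y = \<alpha> X * \<beta> Y - \<alpha> Y * \<beta> X"

definition wedge_1_2 ::
  "(real^'m::finite \<Rightarrow> real) \<Rightarrow> (real^'m \<Rightarrow> real^'m \<Rightarrow> real)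
    \<Rightarrow> real^'m \<Rightarrow> real^'m \<Rightarrow> real^'m \<Rightarrow> real" where
  "wedge_1_2 \<alpha> \<omega> X Y Z = \<alpha> X * \<omega> Y Z - \<alpha> Y * \<omega> X Z + \<alpha> Z * \<omega> X Y"

definition dx :: "'m::finite \<Rightarrow> real^'m \<Rightarrow> real" where
  "dx i X = X $ i"

definition ext_d0 :: "(real^'m::finite \<Rightarrow> real) \<Rightarrow> real^'m \<Rightarrow> real^'m \<Rightarrow> real" where
  "ext_d0 f p = frechet_derivative f (at p)"

text \<open>
  A 1-form \<open>\<alpha>\<close> has coefficients $\alpha_I = \alpha(e_I)$, and
  $d\alpha = \sum_I d\alpha_I \wedge dx^I = \sum_{I,J} \partial_J \alpha_I \, dx^J \wedge dx^I$.
\<close>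

definition ext_d1 ::
  "(real^'m::finite \<Rightarrow> real^'m \<Rightarrow> real) \<Rightarrow> real^'m \<Rightarrow> real^'m \<Rightarrow> real^'m \<Rightarrow> real" where
  "ext_d1 \<alpha> p X Y = (\<Sum>i\<in>UNIV. wedge_1_1 (ext_d0 (\<lambda>q. \<alpha> q (axis i 1)) p) (dx i) X Y)"

definition Theta ::
  "(real^'m::finite \<Rightarrow> real^'m) \<Rightarrow> (real^'m \<Rightarrow> real) \<Rightarrow> real^'m \<Rightarrow> real^'m \<Rightarrow> real" where
  "Theta F w p X = ext_d0 w p X + (\<Sum>i\<in>UNIV. F p $ i * dx i X)"

definition nonintegrable_at ::
  "(real^'m::finite \<Rightarrow> real^'m \<Rightarrow> real) \<Rightarrow> real^'m \<Rightarrow> bool" where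
  "nonintegrable_at \<alpha> p \<longleftrightarrow> wedge_1_2 (\<alpha> p) (ext_d1 \<alpha> p) \<noteq> (\<lambda>X Y Z. 0)"

end

theory Submission
  imports Defs
begin

text \<open>
  Write \<open>G = \<nabla>u + F\<close> and \<open>H = \<nabla>v + F\<close>; these are the coefficient vectors of \<open>\<Theta>\<^sub>u\<close> and \<open>\<Theta>\<^sub>v\<close>.
  Where both are nonzero, equality of the horizontal normals says \<open>G = \<lambda> H\<close> with the positive
  differentiable factor \<open>\<lambda> = \<bar>G\<bar> / \<bar>H\<bar>\<close>, hence \<open>\<Theta>\<^sub>u = \<lambda> \<Theta>\<^sub>v\<close>. Since second derivatives commute
  (\<open>second_derivative_symmetric\<close>), \<open>\<Theta>\<^sub>u\<close> and \<open>\<Theta>\<^sub>v\<close> have the same exterior derivative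
  \<open>\<omega> = d(\<Sum>\<^sub>I F\<^sub>I dx\<^sup>I)\<close> (\<open>ext_d1_Theta_cong\<close>). Differentiating \<open>\<Theta>\<^sub>u = \<lambda> \<Theta>\<^sub>v\<close> therefore gives
  \<open>(1 - \<lambda>) \<omega> = d\<lambda> \<and> \<Theta>\<^sub>v\<close>, and wedging with \<open>\<Theta>\<^sub>v\<close> kills the right-hand side:
  \<open>(1 - \<lambda>) \<Theta>\<^sub>v \<and> \<omega> = 0\<close> (\<open>wedge_eq_0_of_rescaling\<close>). The two forms being proportional with a
  nonzero factor and having the same derivative, nonintegrability of either one means
  \<open>\<Theta>\<^sub>v \<and> \<omega> \<noteq> 0\<close>. So \<open>\<lambda> = 1\<close>, that is \<open>G = H\<close> and \<open>\<nabla>u = \<nabla>v\<close>.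
\<close>

section \<open>Symmetry of second derivatives\<close>

text \<open>
  The mean value theorem in direction \<open>X\<close> turns the second difference into \<open>t\<close> times an
  increment of the gradient \<open>g\<close> in direction \<open>Y\<close>, taken between two points at distance \<open>O(t)\<close>
  from \<open>p\<close>; differentiability of \<open>g\<close> at \<open>p\<close> determines that increment up to \<open>o(t)\<close>.
\<close>

lemma second_difference_estimate:
  fixes f :: "'a::real_inner \<Rightarrow> real"
  assumes "open S" "p \<in> S"
    and grd: "\<And>q. q \<in> S \<Longrightarrow> GDERIV f q :> g q"
    and A: "(g has_derivative A) (at p)"
    and "e > 0"
  shows "\<exists>d>0. \<forall>t. 0 < t \<and> t < d \<longrightarrow>
    \<bar>f (p + t *\<^sub>R X + t *\<^sub>R Y) - f (p + t *\<^sub>R X) - f (p + t *\<^sub>R Y) + f p - t\<^sup>2 * (A Y \<bullet> X)\<bar>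
      \<le> 2 * e * (norm X + norm Y)\<^sup>2 * t\<^sup>2"
proof -
  let ?M = "norm X + norm Y"
  interpret A: bounded_linear A
    using A by (rule has_derivative_bounded_linear)
  obtain r where "r > 0" and r: "ball p r \<subseteq> S"
    using \<open>open S\<close> \<open>p \<in> S\<close> open_contains_ball by blast
  obtain d where "d > 0"
    and d: "\<And>y. norm (y - p) < d \<Longrightarrow> norm (g y - g p - A (y - p)) \<le> e * norm (y - p)"
    using A \<open>e > 0\<close> unfolding has_derivative_at_alt by blast
  \<comment> \<open>For \<open>t < d'\<close> the parallelogram spanned by \<open>t X\<close> and \<open>t Y\<close> at \<open>p\<close> stays within distance
    \<open>min r d\<close> of \<open>p\<close>; the added 1 covers the case \<open>X = Y = 0\<close>.\<close>
  define d' where "d' = min r d / (?M + 1)"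
  have M1: "?M + 1 > 0" by (simp add: add_nonneg_pos)
  have "d' > 0" using \<open>r > 0\<close> \<open>d > 0\<close> M1 by (simp add: d'_def)
  moreover have "\<bar>f (p + t *\<^sub>R X + t *\<^sub>R Y) - f (p + t *\<^sub>R X) - f (p + t *\<^sub>R Y) + f p - t\<^sup>2 * (A Y \<bullet> X)\<bar>
      \<le> 2 * e * ?M\<^sup>2 * t\<^sup>2" if "0 < t" "t < d'" for t
  proof -
    have "t * (?M + 1) < min r d"
      using \<open>t < d'\<close> M1 by (simp add: d'_def pos_less_divide_eq)
    then have tM: "t * ?M < r" "t * ?M < d"
      using \<open>0 < t\<close> by (auto simp: algebra_simps)
    have small: "norm (s *\<^sub>R X + b *\<^sub>R Y) \<le> t * ?M"
      if "0 \<le> s" "s \<le> t" "0 \<le> b" "b \<le> t" for s b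
    proof -
      have "norm (s *\<^sub>R X + b *\<^sub>R Y) \<le> s * norm X + b * norm Y"
        using that by (metis abs_of_nonneg norm_scaleR norm_triangle_ineq)
      also have "\<dots> \<le> t * norm X + t * norm Y"
        using that by (intro add_mono mult_right_mono) auto
      finally show ?thesis by (simp add: algebra_simps)
    qed
    have inS: "p + s *\<^sub>R X + b *\<^sub>R Y \<in> S" if "0 \<le> s" "s \<le> t" "0 \<le> b" "b \<le> t" for s b
    proof -
      have "norm (s *\<^sub>R X + b *\<^sub>R Y) < r"
        using small[OF that] tM by linarith
      then have "dist p (p + s *\<^sub>R X + b *\<^sub>R Y) < r"
        by (metis add.assoc add_diff_cancel_left' dist_commute dist_norm)
      then show ?thesis using r by auto
    qed
    have slope: "((\<lambda>s. f (p + s *\<^sub>R X + b *\<^sub>R Y)) has_derivative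
        (\<lambda>h. h * (X \<bullet> g (p + s *\<^sub>R X + b *\<^sub>R Y)))) (at s within {0..t})"
      if "0 \<le> s" "s \<le> t" "0 \<le> b" "b \<le> t" for s b
    proof -
      have "(f has_derivative (\<lambda>h. h \<bullet> g (p + s *\<^sub>R X + b *\<^sub>R Y))) (at (p + s *\<^sub>R X + b *\<^sub>R Y))"
        using grd[OF inS[OF that]] by (simp add: gderiv_def)
      moreover have "((\<lambda>s. p + s *\<^sub>R X + b *\<^sub>R Y) has_derivative (\<lambda>h. h *\<^sub>R X)) (at s within {0..t})"
        by (auto intro!: derivative_eq_intros)
      ultimately show ?thesis
        using has_derivative_compose by fastforce
    qed
    have "((\<lambda>s. f (p + s *\<^sub>R X + t *\<^sub>R Y) - f (p + s *\<^sub>R X)) has_derivative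
        (\<lambda>h. h * (X \<bullet> g (p + s *\<^sub>R X + t *\<^sub>R Y)) - h * (X \<bullet> g (p + s *\<^sub>R X)))) (at s within {0..t})"
      if "0 \<le> s" "s \<le> t" for s
      using has_derivative_diff[OF slope[of s t] slope[of s 0]] that \<open>0 < t\<close> by simp
    from mvt_simple[OF \<open>0 < t\<close> this] obtain s where s: "0 < s" "s < t"
      and mv: "f (p + t *\<^sub>R X + t *\<^sub>R Y) - f (p + t *\<^sub>R X) - (f (p + t *\<^sub>R Y) - f p)
        = t * (X \<bullet> g (p + s *\<^sub>R X + t *\<^sub>R Y)) - t * (X \<bullet> g (p + s *\<^sub>R X))"
      by auto
    define R where "R b = g (p + s *\<^sub>R X + b *\<^sub>R Y) - g p - A (s *\<^sub>R X + b *\<^sub>R Y)" for b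
    have R: "norm (R b) \<le> e * (t * ?M)" if "0 \<le> b" "b \<le> t" for b
    proof -
      have n: "norm (s *\<^sub>R X + b *\<^sub>R Y) \<le> t * ?M" using small[of s b] s that by simp
      have "norm (R b) \<le> e * norm (s *\<^sub>R X + b *\<^sub>R Y)"
        using d[of "p + s *\<^sub>R X + b *\<^sub>R Y"] n tM by (simp add: R_def add.assoc)
      also have "\<dots> \<le> e * (t * ?M)" using n \<open>e > 0\<close> by (simp add: mult_left_mono)
      finally show ?thesis .
    qed
    have "g (p + s *\<^sub>R X + t *\<^sub>R Y) - g (p + s *\<^sub>R X) = t *\<^sub>R A Y + (R t - R 0)"
      by (simp add: R_def A.add A.scaleR)
    then have "X \<bullet> g (p + s *\<^sub>R X + t *\<^sub>R Y) - X \<bullet> g (p + s *\<^sub>R X) = t * (A Y \<bullet> X) + X \<bullet> (R t - R 0)"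
      by (metis inner_add_right inner_commute inner_diff_right inner_scaleR_right)
    then have "t * (X \<bullet> g (p + s *\<^sub>R X + t *\<^sub>R Y)) - t * (X \<bullet> g (p + s *\<^sub>R X))
        = t * (t * (A Y \<bullet> X) + X \<bullet> (R t - R 0))"
      by (metis right_diff_distrib)
    then have "\<bar>f (p + t *\<^sub>R X + t *\<^sub>R Y) - f (p + t *\<^sub>R X) - f (p + t *\<^sub>R Y) + f p - t\<^sup>2 * (A Y \<bullet> X)\<bar>
        = \<bar>t * (X \<bullet> (R t - R 0))\<bar>"
      using mv by (simp add: algebra_simps power2_eq_square)
    also have "\<dots> = t * \<bar>X \<bullet> (R t - R 0)\<bar>"
      using \<open>0 < t\<close> by (simp add: abs_mult)
    also have "\<dots> \<le> t * (?M * (2 * (e * (t * ?M))))"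
    proof (intro mult_left_mono)
      have "\<bar>X \<bullet> (R t - R 0)\<bar> \<le> norm X * norm (R t - R 0)" by (rule Cauchy_Schwarz_ineq2)
      also have "\<dots> \<le> ?M * (2 * (e * (t * ?M)))"
      proof (intro mult_mono)
        show "norm (R t - R 0) \<le> 2 * (e * (t * ?M))"
          using norm_triangle_ineq4[of "R t" "R 0"] R[of t] R[of 0] \<open>0 < t\<close> by linarith
      qed auto
      finally show "\<bar>X \<bullet> (R t - R 0)\<bar> \<le> ?M * (2 * (e * (t * ?M)))" .
    qed (use \<open>0 < t\<close> in simp)
    also have "\<dots> = 2 * e * ?M\<^sup>2 * t\<^sup>2" by (simp add: power2_eq_square)
    finally show ?thesis .
  qed
  ultimately show ?thesis by blast
qed

text \<open>
  The second difference is symmetric in \<open>X\<close> and \<open>Y\<close>, hence so is its coefficient of \<open>t\<^sup>2\<close>.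
\<close>

lemma second_derivative_symmetric:
  fixes f :: "'a::real_inner \<Rightarrow> real"
  assumes "open S" "p \<in> S"
    and "\<And>q. q \<in> S \<Longrightarrow> GDERIV f q :> g q"
    and "(g has_derivative A) (at p)"
  shows "A X \<bullet> Y = A Y \<bullet> X"
proof -
  let ?c = "\<bar>A X \<bullet> Y - A Y \<bullet> X\<bar>" and ?K = "4 * (norm X + norm Y)\<^sup>2"
  have le: "?c \<le> e * ?K" if "e > 0" for e
  proof -
    obtain d1 where "d1 > 0" and d1: "\<And>t. 0 < t \<Longrightarrow> t < d1 \<Longrightarrow>
      \<bar>f (p + t *\<^sub>R X + t *\<^sub>R Y) - f (p + t *\<^sub>R X) - f (p + t *\<^sub>R Y) + f p - t\<^sup>2 * (A Y \<bullet> X)\<bar>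
        \<le> 2 * e * (norm X + norm Y)\<^sup>2 * t\<^sup>2"
      using second_difference_estimate[OF assms \<open>e > 0\<close>, of X Y] by blast
    obtain d2 where "d2 > 0" and d2: "\<And>t. 0 < t \<Longrightarrow> t < d2 \<Longrightarrow>
      \<bar>f (p + t *\<^sub>R Y + t *\<^sub>R X) - f (p + t *\<^sub>R Y) - f (p + t *\<^sub>R X) + f p - t\<^sup>2 * (A X \<bullet> Y)\<bar>
        \<le> 2 * e * (norm Y + norm X)\<^sup>2 * t\<^sup>2"
      using second_difference_estimate[OF assms \<open>e > 0\<close>, of Y X] by blast
    define t where "t = min d1 d2 / 2"
    have t: "0 < t" "t < d1" "t < d2"
      using \<open>d1 > 0\<close> \<open>d2 > 0\<close> by (auto simp: t_def)
    have comm: "p + t *\<^sub>R Y + t *\<^sub>R X = p + t *\<^sub>R X + t *\<^sub>R Y" "norm Y + norm X = norm X + norm Y"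
      by (simp_all add: ac_simps)
    have "\<bar>t\<^sup>2 * (A X \<bullet> Y) - t\<^sup>2 * (A Y \<bullet> X)\<bar> \<le> 4 * e * (norm X + norm Y)\<^sup>2 * t\<^sup>2"
      using d1[OF t(1,2)] d2[OF t(1,3)] unfolding comm by linarith
    moreover have "\<bar>t\<^sup>2 * (A X \<bullet> Y) - t\<^sup>2 * (A Y \<bullet> X)\<bar> = t\<^sup>2 * ?c"
      by (simp add: abs_mult flip: right_diff_distrib)
    ultimately have "t\<^sup>2 * ?c \<le> t\<^sup>2 * (e * ?K)"
      by (simp add: mult_ac)
    then show ?thesis using \<open>0 < t\<close> by simp
  qed
  have "?c = 0"
  proof (rule ccontr)
    assume "?c \<noteq> 0"
    then have "?c > 0" by simp
    \<comment> \<open>Take \<open>e = ?c / (?K + 1)\<close>; the 1 makes the resulting factor \<open>?K / (?K + 1)\<close> less than one.\<close>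
    have K: "?K + 1 > 0" by (simp add: add_nonneg_pos)
    have "?c \<le> ?c / (?K + 1) * ?K"
      using le[of "?c / (?K + 1)"] \<open>?c > 0\<close> K by simp
    then have "?c * (?K + 1) \<le> ?c * ?K"
      using K by (simp add: field_simps)
    then show False using \<open>?c > 0\<close> by (simp add: distrib_left)
  qed
  then show ?thesis by simp
qed

section \<open>The form \<open>\<Theta>\<close> and its exterior derivative\<close>

lemma C1_field_differentiable:
  assumes "open \<Omega>" "Ck_field_on 1 \<Omega> F" "p \<in> \<Omega>"
  shows "F differentiable (at p)"
proof -
  have "(\<lambda>q. F q $ i) differentiable (at p)" for i
    using assms by (simp add: Ck_field_on_def differentiable_on_eq_differentiable_at)
  then show ?thesis
    unfolding differentiable_componentwise_within[of F]
    by (auto simp: Basis_vec_def inner_axis)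
qed

lemma C2_imp_differentiable:
  assumes "open \<Omega>" "Ck_on 2 \<Omega> w" "p \<in> \<Omega>"
  shows "w differentiable (at p)" and "grad w differentiable (at p)"
proof -
  have w: "w differentiable_on \<Omega>" "Ck_on 1 \<Omega> (partial_deriv i w)" for i
    using assms(2) by (simp_all add: numeral_2_eq_2)
  show "w differentiable (at p)"
    using w assms by (simp add: differentiable_on_eq_differentiable_at)
  have "Ck_field_on 1 \<Omega> (grad w)"
    using w(2) by (simp only: Ck_field_on_def grad_def vec_lambda_beta) auto
  then show "grad w differentiable (at p)"
    using C1_field_differentiable assms by blast
qed

lemma Theta_eq_inner:
  assumes "w differentiable (at p)"
  shows "Theta F w p X = (grad w p + F p) \<bullet> X"
proof -
  have "GDERIV w p :> grad w p" using assms by (rule GDERIV_grad)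
  then have "frechet_derivative w (at p) = (\<lambda>h. h \<bullet> grad w p)"
    unfolding gderiv_def by (rule frechet_derivative_at[symmetric])
  then show ?thesis
    by (simp add: Theta_def ext_d0_def dx_def inner_vec_def sum.distrib algebra_simps)
qed

lemma ext_d1_Theta:
  assumes D: "((\<lambda>q. grad w q + F q) has_derivative D) (at p)"
  shows "ext_d1 (Theta F w) p X Y = D X \<bullet> Y - D Y \<bullet> X"
proof -
  have coeff: "Theta F w q (axis i 1) = (grad w q + F q) $ i" for q i
    by (simp add: Theta_def ext_d0_def dx_def grad_def partial_deriv_def axis_def if_distrib cong: if_cong)
  have "((\<lambda>q. (grad w q + F q) $ i) has_derivative (\<lambda>h. D h $ i)) (at p)" for i
    using D by (rule bounded_linear.has_derivative[OF bounded_linear_vec_nth])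
  then have "ext_d0 (\<lambda>q. Theta F w q (axis i 1)) p = (\<lambda>h. D h $ i)" for i
    unfolding coeff ext_d0_def by (rule frechet_derivative_at[symmetric])
  then show ?thesis
    by (simp add: ext_d1_def wedge_1_1_def dx_def inner_vec_def sum_subtractf)
qed

text \<open>
  This is \<open>d(dw) = 0\<close>: the Hessian of \<open>w\<close> contributes a symmetric bilinear form, which the
  antisymmetrisation in \<open>ext_d1_Theta\<close> removes, and only \<open>dF\<close> is left.
\<close>

lemma ext_d1_Theta_eq_field:
  assumes "open \<Omega>" "Ck_on 2 \<Omega> w" "p \<in> \<Omega>" and B: "(F has_derivative B) (at p)"
  shows "ext_d1 (Theta F w) p X Y = B X \<bullet> Y - B Y \<bullet> X"
proof -
  obtain A where A: "(grad w has_derivative A) (at p)"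
    using C2_imp_differentiable(2)[OF assms(1-3)] unfolding differentiable_def by blast
  have "A X \<bullet> Y = A Y \<bullet> X"
    by (rule second_derivative_symmetric[OF \<open>open \<Omega>\<close> \<open>p \<in> \<Omega>\<close> _ A])
      (use C2_imp_differentiable(1)[OF assms(1,2)] GDERIV_grad in blast)
  then show ?thesis
    using ext_d1_Theta[OF has_derivative_add[OF A B]] by (simp add: inner_add_left)
qed

lemma ext_d1_Theta_cong:
  assumes "open \<Omega>" "Ck_on 2 \<Omega> u" "Ck_on 2 \<Omega> v" "Ck_field_on 1 \<Omega> F" "p \<in> \<Omega>"
  shows "ext_d1 (Theta F u) p = ext_d1 (Theta F v) p"
proof -
  obtain B where "(F has_derivative B) (at p)"
    using C1_field_differentiable assms unfolding differentiable_def by blast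
  then show ?thesis
    using assms by (intro ext) (simp add: ext_d1_Theta_eq_field)
qed

section \<open>Rescaling without changing the exterior derivative\<close>

text \<open>
  With \<open>\<beta> = \<Theta>\<^sub>v\<close>, \<open>c = \<lambda>\<close> and \<open>L = d\<lambda>\<close>, the hypothesis is the product rule for \<open>d(\<lambda>\<Theta>\<^sub>v)\<close> in the
  case where rescaling leaves the exterior derivative \<open>\<omega>\<close> unchanged. It makes \<open>\<omega>\<close> a multiple of
  \<open>L \<and> \<beta>\<close>, and \<open>\<beta> \<and> L \<and> \<beta> = 0\<close>.
\<close>

lemma wedge_eq_0_of_rescaling:
  assumes \<omega>: "\<And>X Y. \<omega> X Y = wedge_1_1 L \<beta> X Y + c * \<omega> X Y" and "c \<noteq> 1"
  shows "wedge_1_2 \<beta> \<omega> = (\<lambda>X Y Z. 0)"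
proof (intro ext)
  fix X Y Z
  have multiple: "(1 - c) * \<omega> X Y = wedge_1_1 L \<beta> X Y" for X Y
    using \<omega>[of X Y] by (simp add: left_diff_distrib)
  have "(1 - c) * wedge_1_2 \<beta> \<omega> X Y Z =
      \<beta> X * ((1 - c) * \<omega> Y Z) - \<beta> Y * ((1 - c) * \<omega> X Z) + \<beta> Z * ((1 - c) * \<omega> X Y)"
    by (simp add: wedge_1_2_def algebra_simps)
  also have "\<dots> = 0"
    unfolding multiple by (simp add: wedge_1_1_def algebra_simps)
  finally show "wedge_1_2 \<beta> \<omega> X Y Z = 0" using \<open>c \<noteq> 1\<close> by simp
qed

text \<open>
  The product rule \<open>d(c \<Theta>\<^sub>v) = dc \<and> \<Theta>\<^sub>v + c d\<Theta>\<^sub>v\<close>; the proportionality has to hold on a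
  neighbourhood of \<open>p\<close> so that it can be differentiated there.
\<close>

lemma ext_d1_Theta_rescale:
  assumes "open U" "p \<in> U"
    and rescale: "\<And>q. q \<in> U \<Longrightarrow> grad u q + F q = c q *\<^sub>R (grad v q + F q)"
    and D: "((\<lambda>q. grad v q + F q) has_derivative D) (at p)"
    and L: "(c has_derivative L) (at p)"
    and "v differentiable (at p)"
  shows "ext_d1 (Theta F u) p X Y = wedge_1_1 L (Theta F v p) X Y + c p * ext_d1 (Theta F v) p X Y"
proof -
  have "((\<lambda>q. c q *\<^sub>R (grad v q + F q)) has_derivative
      (\<lambda>h. c p *\<^sub>R D h + L h *\<^sub>R (grad v p + F p))) (at p)"
    using L D by (rule has_derivative_scaleR)
  then have "((\<lambda>q. grad u q + F q) has_derivative
      (\<lambda>h. c p *\<^sub>R D h + L h *\<^sub>R (grad v p + F p))) (at p)"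
    by (rule has_derivative_transform_within_open[OF _ \<open>open U\<close> \<open>p \<in> U\<close>]) (simp add: rescale)
  from ext_d1_Theta[OF this] ext_d1_Theta[OF D] show ?thesis
    unfolding wedge_1_1_def Theta_eq_inner[OF \<open>v differentiable (at p)\<close>]
    by (simp only: inner_add_left inner_scaleR_left right_diff_distrib)
qed

lemma rescaling_of_horizontal_normal_eq:
  assumes "horizontal_normal F u p = horizontal_normal F v p" and "grad u p + F p \<noteq> 0"
  shows "grad u p + F p = (norm (grad u p + F p) / norm (grad v p + F p)) *\<^sub>R (grad v p + F p)"
proof -
  have "grad u p + F p = norm (grad u p + F p) *\<^sub>R horizontal_normal F u p"
    using assms(2) by (simp add: horizontal_normal_def)
  also have "\<dots> = norm (grad u p + F p) *\<^sub>R horizontal_normal F v p"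
    by (simp only: assms(1))
  finally show ?thesis
    by (simp add: horizontal_normal_def divide_inverse)
qed

theorem theoremB:
  fixes \<Omega> :: "(real^'m::finite) set"
    and u v :: "real^'m \<Rightarrow> real"
    and F :: "real^'m \<Rightarrow> real^'m"
  assumes "open \<Omega>" and "connected \<Omega>"
    and "Ck_on 2 \<Omega> u" and "Ck_on 2 \<Omega> v"
    and "Ck_field_on 1 \<Omega> F"
    and "\<And>p. p \<in> \<Omega> - (singular_set \<Omega> F u \<union> singular_set \<Omega> F v) \<Longrightarrow>
           horizontal_normal F u p = horizontal_normal F v p"
    and "\<And>p. p \<in> \<Omega> - (singular_set \<Omega> F u \<union> singular_set \<Omega> F v) \<Longrightarrow>
           nonintegrable_at (Theta F u) p \<or> nonintegrable_at (Theta F v) p"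
  shows "\<forall>p \<in> \<Omega> - (singular_set \<Omega> F u \<union> singular_set \<Omega> F v). grad u p = grad v p"
proof
  fix p assume p: "p \<in> \<Omega> - (singular_set \<Omega> F u \<union> singular_set \<Omega> F v)"
  define G where "G q = grad u q + F q" for q
  define H where "H q = grad v q + F q" for q
  define c where "c q = norm (G q) / norm (H q)" for q
  define U where "U = {q \<in> \<Omega>. G q \<noteq> 0} \<inter> {q \<in> \<Omega>. H q \<noteq> 0}"
  have U_eq: "U = \<Omega> - (singular_set \<Omega> F u \<union> singular_set \<Omega> F v)"
    by (auto simp: U_def G_def H_def singular_set_def)
  have pU: "p \<in> U" "p \<in> \<Omega>" "G p \<noteq> 0" "H p \<noteq> 0"
    using p unfolding U_eq[symmetric] by (auto simp: U_def)
  have diffG: "G differentiable (at q)" and diffH: "H differentiable (at q)" if "q \<in> \<Omega>" for q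
    unfolding G_def[abs_def] H_def[abs_def]
    using C2_imp_differentiable(2) C1_field_differentiable assms(1,3,4,5) that
    by (blast intro: differentiable_add)+
  have "continuous_on \<Omega> G" "continuous_on \<Omega> H"
    using diffG diffH
    by (auto intro!: differentiable_imp_continuous_on differentiable_at_imp_differentiable_on)
  then have "open (\<Omega> \<inter> G -` (- {0}))" "open (\<Omega> \<inter> H -` (- {0}))"
    using \<open>open \<Omega>\<close> by (auto intro!: continuous_open_preimage)
  moreover have "U = (\<Omega> \<inter> G -` (- {0})) \<inter> (\<Omega> \<inter> H -` (- {0}))"
    by (auto simp: U_def)
  ultimately have "open U" by auto
  have rescale: "grad u q + F q = c q *\<^sub>R (grad v q + F q)" if "q \<in> U" for q
    using rescaling_of_horizontal_normal_eq[OF assms(6)] that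
    unfolding U_eq[symmetric] c_def G_def H_def by (simp add: U_def G_def)
  obtain D where D: "((\<lambda>q. grad v q + F q) has_derivative D) (at p)"
    using diffH[OF pU(2)] unfolding H_def[abs_def] differentiable_def by blast
  have "(\<lambda>q. norm (G q)) differentiable (at p)" "(\<lambda>q. norm (H q)) differentiable (at p)"
    using differentiable_compose[OF differentiable_norm_at diffG]
      differentiable_compose[OF differentiable_norm_at diffH] pU by auto
  then have "c differentiable (at p)"
    unfolding c_def[abs_def] using pU by (intro differentiable_divide) auto
  then obtain L where L: "(c has_derivative L) (at p)"
    unfolding differentiable_def by blast
  let ?\<omega> = "ext_d1 (Theta F v) p"
  have diff: "u differentiable (at p)" "v differentiable (at p)"
    using C2_imp_differentiable(1) assms(1,3,4) pU(2) by blast+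
  have same: "ext_d1 (Theta F u) p = ?\<omega>"
    using ext_d1_Theta_cong assms(1,3,4,5) pU(2) by blast
  have \<omega>: "?\<omega> X Y = wedge_1_1 L (Theta F v p) X Y + c p * ?\<omega> X Y" for X Y
    using ext_d1_Theta_rescale[OF \<open>open U\<close> pU(1) rescale D L diff(2), of X Y] unfolding same .
  \<comment> \<open>Since \<open>\<Theta>\<^sub>u = c \<Theta>\<^sub>v\<close> with the same exterior derivative, whichever form is assumed
    nonintegrable, it is \<open>\<Theta>\<^sub>v \<and> \<omega>\<close> that does not vanish.\<close>
  have "Theta F u p X = c p * Theta F v p X" for X
    using rescale[OF pU(1)] by (simp only: Theta_eq_inner[OF diff(1)] Theta_eq_inner[OF diff(2)]
      inner_scaleR_left)
  then have "wedge_1_2 (Theta F u p) ?\<omega> X Y Z = c p * wedge_1_2 (Theta F v p) ?\<omega> X Y Z" for X Y Z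
    by (simp add: wedge_1_2_def algebra_simps)
  then have "wedge_1_2 (Theta F v p) ?\<omega> \<noteq> (\<lambda>X Y Z. 0)"
    using assms(7)[OF p] unfolding nonintegrable_at_def same by (auto simp: fun_eq_iff)
  then have "c p = 1"
    using wedge_eq_0_of_rescaling[of ?\<omega>, OF \<omega>] by blast
  then show "grad u p = grad v p"
    using rescale[OF pU(1)] by simp
qed

end
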